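(* Let $L = D_4 \subseteq \mathbb{R}^4$. Then for every $\alpha \geq 5$, the deep holes of $L$ are the unique minimizers of the function $z \mapsto p(f_\alpha, L, z) = \sum_{x \in L} e^{-\alpha\|x-z\|^2}$ over $\mathbb{R}^4$; that is, the set of minimizers equals the set of deep holes of $L$.
   Context: $D_4 = \{x \in \mathbb{Z}^4 : \sum_i x_i \equiv 0 \pmod 2\}$. A deep hole of $L \subseteq \mathbb{R}^n$ is a point $c \in \mathbb{R}^n$ with $\min_{x\in L}\|x-c\| = \max_{z \in \mathbb{R}^n}\min_{x \in L}\|x-z\|$. *)

theory Defs
  imports "HOL-Analysis.Analysis"
begin

definition D4 :: "(real ^ 4) set" where
  "D4 = {(\<chi> i. real_of_int (k $ i)) | k :: int ^ 4. even (\<Sum>i\<in>UNIV. k $ i)}"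

(* For nonempty L, infdist z L is the infimum of dist z x over x in L; it is a minimum
   when L is closed, as it is for a lattice. The universal quantifier says that the maximum
   over z exists and is attained at c. *)
definition deep_hole :: "'a::euclidean_space set \<Rightarrow> 'a \<Rightarrow> bool" where
  "deep_hole L c \<longleftrightarrow> (\<forall>z. infdist z L \<le> infdist c L)"

definition gaussian :: "real \<Rightarrow> real \<Rightarrow> real" where
  "gaussian \<alpha> r = exp (- \<alpha> * r\<^sup>2)"

definition potential :: "(real \<Rightarrow> real) \<Rightarrow> 'a::euclidean_space set \<Rightarrow> 'a \<Rightarrow> real" where
  "potential f L z = (\<Sum>\<^sub>\<infinity>x\<in>L. f (norm (x - z)))"

definition minimizers :: "('a \<Rightarrow> real) \<Rightarrow> 'a set" where
  "minimizers g = {z. \<forall>w. g z \<le> g w}"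

end

theory Submission
  imports Defs
begin

text \<open>Every point of space is moved by a symmetry of $D_4$ to a point $e_1 + y$ with
  $\|y\|_1 \le 1$, and $e_1$ is a deep hole with distance $1$ to $D_4$. So it suffices that both the
  distance to $D_4$ and the potential, along this cross polytope, have their strict extremum at $y = 0$.
  For the potential, expand $e^{-\alpha\|x-y\|^2}$ over the shifted lattice $O = D_4 - e_1$ of integer
  vectors with odd coordinate sum. Distribute the weight $e^{-\alpha\|x\|^2}$ of $x \in O$ over the
  coordinates in proportion to $x_j^2$ and average over sign changes. Since nonzero coordinates
  satisfy $|x_j| \ge 1$, the ratio of the potentials at $e_1 + y$ and $e_1$ is at
  least $e^{-\alpha\|y\|^2} \cdot \frac14 \sum_j \cosh(2\alpha y_j)$. Thus all
  shells of $O$ are controlled by the first one, and no tail estimate is needed. For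
  $\alpha \ge 5$ and $0 < \|y\|_1 \le 1$ this factor exceeds $1$.\<close>

section \<open>An inequality for averages of hyperbolic cosines\<close>

text \<open>Convexity of $u \mapsto \cosh\sqrt u$, obtained termwise from Bernoulli's inequality.\<close>

lemma cosh_sqrt_average:
  fixes t :: "'i \<Rightarrow> real" and s :: real
  assumes "finite I" and avg: "(\<Sum>i\<in>I. (t i)\<^sup>2) = card I * s\<^sup>2"
  shows "card I * cosh s \<le> (\<Sum>i\<in>I. cosh (t i))"
proof (cases "s = 0")
  case True
  have "(\<Sum>i\<in>I. 1) \<le> (\<Sum>i\<in>I. cosh (t i))"
    by (intro sum_mono cosh_real_ge_1)
  then show ?thesis using True by simp
next
  case False
  let ?c = "\<lambda>x n. if even n then x ^ n /\<^sub>R fact n else (0::real)"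
  have "(\<lambda>n. card I * ?c s n) sums (card I * cosh s)"
    by (intro sums_mult cosh_converges)
  moreover have "(\<lambda>n. \<Sum>i\<in>I. ?c (t i) n) sums (\<Sum>i\<in>I. cosh (t i))"
    by (intro sums_sum cosh_converges)
  moreover have "card I * ?c s n \<le> (\<Sum>i\<in>I. ?c (t i) n)" for n
  proof (cases "even n")
    case True
    then obtain m where n: "n = 2 * m" by blast
    \<comment> \<open>Bernoulli is applied to (t_i/s)^2 - 1, which is at least -1; by
      \<open>avg\<close> these numbers sum to 0 over \<open>I\<close>, so the linear terms
      cancel.\<close>
    have "card I * (s\<^sup>2) ^ m = (s\<^sup>2) ^ m * (\<Sum>i\<in>I. 1 + m * ((t i)\<^sup>2 / s\<^sup>2 - 1))"
      using False by (simp add: sum.distrib sum_subtractf avg flip: sum_distrib_left sum_divide_distrib)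
    also have "\<dots> \<le> (s\<^sup>2) ^ m * (\<Sum>i\<in>I. (1 + ((t i)\<^sup>2 / s\<^sup>2 - 1)) ^ m)"
      by (intro mult_left_mono sum_mono Bernoulli_inequality) auto
    also have "\<dots> = (\<Sum>i\<in>I. ((t i)\<^sup>2) ^ m)"
      using False by (simp add: sum_distrib_left power_divide)
    finally have "card I * s ^ n \<le> (\<Sum>i\<in>I. t i ^ n)"
      unfolding n power_mult .
    then have "card I * s ^ n / fact n \<le> (\<Sum>i\<in>I. t i ^ n) / fact n"
      by (rule divide_right_mono) simp
    then show ?thesis
      using True by (simp add: sum_divide_distrib divide_inverse mult_ac flip: sum_distrib_left)
  qed simp
  ultimately show ?thesis
    by (rule sums_le[rotated])
qed

lemma cosh_ge_one_plus_square:
  "1 + x\<^sup>2 / 2 \<le> cosh (x::real)"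
proof -
  let ?c = "\<lambda>n. if even n then x ^ n /\<^sub>R fact n else (0::real)"
  have "sum ?c {..<3} \<le> suminf ?c"
    using cosh_converges[of x] by (intro sum_le_suminf) (auto simp: sums_iff zero_le_even_power)
  then show ?thesis
    using cosh_converges[of x] by (simp add: sums_iff numeral_3_eq_3 field_simps power2_eq_square)
qed

text \<open>Two regimes of v = \<alpha> r. For v \<le> 2, \<alpha> \<ge> 5 bounds the exponent v r
  by v^2/5, and second-order bounds suffice. For v > 2, the bound on r leaves v r \<le> v - 7/10,
  and exp(-7/10) < 1/2 puts the exponential below exp(v)/2.\<close>

lemma cosh_gt_exp_mult:
  fixes \<alpha> r :: real
  assumes "\<alpha> \<ge> 5" "0 < r" "r \<le> 65/100"
  shows "exp (\<alpha> * r\<^sup>2) < cosh (\<alpha> * r)"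
proof (cases "\<alpha> * r \<le> 2")
  case True
  define v where "v = \<alpha> * r"
  have v: "0 < v" "v \<le> 2" "r \<le> v / 5"
    using assms True by (auto simp: v_def)
  have v2: "v\<^sup>2 \<le> 4"
    using v power_mono[of v 2 2] by simp
  have "exp (\<alpha> * r\<^sup>2) = exp (v * r)"
    by (simp add: v_def power2_eq_square mult_ac)
  also have "\<dots> \<le> exp (v\<^sup>2 / 5)"
    using mult_left_mono[OF v(3), of v] v by (simp add: power2_eq_square)
  also have "\<dots> \<le> 1 + v\<^sup>2 / 5 + (v\<^sup>2 / 5)\<^sup>2"
    by (rule exp_bound) (use v2 in auto)
  also have "\<dots> < 1 + v\<^sup>2 / 2"
  proof -
    have "(v\<^sup>2 / 5)\<^sup>2 \<le> v\<^sup>2 * 4 / 25"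
      using mult_left_mono[OF v2, of "v\<^sup>2"] by (simp add: power2_eq_square)
    moreover have "v\<^sup>2 > 0" using v by simp
    ultimately show ?thesis by linarith
  qed
  also have "\<dots> \<le> cosh v" by (rule cosh_ge_one_plus_square)
  finally show ?thesis by (simp add: v_def)
next
  case False
  define v where "v = \<alpha> * r"
  have "exp (\<alpha> * r\<^sup>2) = exp (v * r)"
    by (simp add: v_def power2_eq_square mult_ac)
  \<comment> \<open>The gap is (1 - 65/100) v > 7/10, since v > 2.\<close>
  also have "v * r \<le> v - 7/10"
    using mult_left_mono[OF assms(3), of v] False by (simp add: v_def)
  also have "exp (v - 7/10) < exp v / 2"
  proof -
    have "exp (ln 2) < exp (7/10::real)"
      using ln2_le_25_over_36 by (subst exp_less_cancel_iff) simp
    then have "exp (v - 7/10) * 2 < exp (v - 7/10) * exp (7/10)" by simp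
    then show ?thesis by (simp flip: exp_add)
  qed
  also have "\<dots> \<le> cosh v" by (simp add: cosh_field_def)
  finally show ?thesis by (simp add: v_def)
qed

text \<open>Take \<open>j\<close> with |y_j| maximal: the sum of y_i^2 is at most |y_j| times the l1
  norm. Both the potential bound and the distance bound rest on this.\<close>

lemma norm_square_le_component:
  fixes y :: "real ^ 'n"
  assumes "(\<Sum>i\<in>UNIV. \<bar>y $ i\<bar>) \<le> 1" "y \<noteq> 0"
  obtains j where "y $ j \<noteq> 0" "(norm y)\<^sup>2 \<le> \<bar>y $ j\<bar>"
proof -
  let ?M = "Max (range (\<lambda>i. \<bar>y $ i\<bar>))"
  have "?M \<in> range (\<lambda>i. \<bar>y $ i\<bar>)" by (rule Max_in) auto
  then obtain j where "?M = \<bar>y $ j\<bar>" by blast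
  then have max: "\<bar>y $ i\<bar> \<le> \<bar>y $ j\<bar>" for i
    using Max_ge[of "range (\<lambda>i. \<bar>y $ i\<bar>)" "\<bar>y $ i\<bar>"] by simp
  then have "y $ j \<noteq> 0" using assms(2) by (auto simp: vec_eq_iff)
  have "(norm y)\<^sup>2 = (\<Sum>i\<in>UNIV. (y $ i)\<^sup>2)"
    unfolding power2_norm_eq_inner inner_vec_def by (simp add: power2_eq_square)
  also have "\<dots> \<le> (\<Sum>i\<in>UNIV. \<bar>y $ j\<bar> * \<bar>y $ i\<bar>)"
  proof (rule sum_mono)
    fix i
    show "(y $ i)\<^sup>2 \<le> \<bar>y $ j\<bar> * \<bar>y $ i\<bar>"
      using mult_right_mono[OF max[of i], of "\<bar>y $ i\<bar>"] by (simp add: power2_eq_square)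
  qed
  also have "\<dots> \<le> \<bar>y $ j\<bar>"
    using mult_left_mono[OF assms(1), of "\<bar>y $ j\<bar>"] by (simp add: sum_distrib_left)
  finally show thesis using that \<open>y $ j \<noteq> 0\<close> by blast
qed

lemma exp_norm_less_average_cosh:
  fixes y :: "real ^ 4"
  assumes "\<alpha> \<ge> 5" and y: "(\<Sum>i\<in>UNIV. \<bar>y $ i\<bar>) \<le> 1" "y \<noteq> 0"
  shows "4 * exp (\<alpha> * (norm y)\<^sup>2) < (\<Sum>i\<in>UNIV. cosh (2 * \<alpha> * y $ i))"
proof -
  obtain j where norm_le: "(norm y)\<^sup>2 \<le> \<bar>y $ j\<bar>"
    using norm_square_le_component[OF y] by blast
  define M where "M = \<bar>y $ j\<bar>"
  note norm_le = norm_le[folded M_def]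
  txt \<open>A large coordinate alone suffices, as $\|y\|^2 \le M$. The threshold is $\ln 8 / 5 < 42/100$.\<close>
  show ?thesis
  proof (cases "M \<ge> 42/100")
    case True
    have "42/100 * 5 \<le> M * \<alpha>"
      using True assms(1) by (intro mult_mono) auto
    then have "exp (3 * ln 2) \<le> exp (\<alpha> * M)"
      using ln2_le_25_over_36 by (subst exp_le_cancel_iff) (simp add: mult.commute)
    moreover have "exp (3 * ln 2) = (8::real)"
      using exp_of_nat_mult[of 3 "ln 2::real"] by simp
    ultimately have *: "8 \<le> exp (\<alpha> * M)" by simp
    have "4 * exp (\<alpha> * (norm y)\<^sup>2) \<le> 4 * exp (\<alpha> * M)"
      using norm_le assms(1) by simp
    \<comment> \<open>With E = exp(\<alpha> M) \<ge> 8, 4 E \<le> E^2 / 2, and E^2 / 2 is the larger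
      half of cosh(2 \<alpha> M).\<close>
    also have "\<dots> \<le> exp (\<alpha> * M) * exp (\<alpha> * M) / 2"
      using mult_right_mono[OF *, of "exp (\<alpha> * M)"] by simp
    also have "\<dots> < cosh (2 * \<alpha> * M)"
      by (simp add: cosh_field_def mult_ac flip: exp_add)
    also have "\<dots> = cosh (2 * \<alpha> * y $ j)"
      using cosh_real_abs[of "2 * \<alpha> * y $ j"] assms(1) by (simp add: M_def abs_mult)
    also have "\<dots> \<le> (\<Sum>i\<in>UNIV. cosh (2 * \<alpha> * y $ i))"
      by (rule member_le_sum) auto
    finally show ?thesis .
  next
    case False
    have "(norm y)\<^sup>2 = (\<Sum>i\<in>UNIV. (y $ i)\<^sup>2)"
      unfolding power2_norm_eq_inner inner_vec_def by (simp add: power2_eq_square)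
    \<comment> \<open>The factor 2^2 matches the four coordinates, so the mean square of the
      arguments is exactly (\<alpha> \<open>norm y\<close>)^2.\<close>
    then have avg: "(\<Sum>i\<in>(UNIV::4 set). (2 * \<alpha> * y $ i)\<^sup>2) = card (UNIV::4 set) * (\<alpha> * norm y)\<^sup>2"
      by (simp add: power_mult_distrib flip: sum_distrib_left)
    \<comment> \<open>42/100 < 4225/10000 = (65/100)^2, which fits the range of
      \<open>cosh_gt_exp_mult\<close>.\<close>
    have "(norm y)\<^sup>2 \<le> (65/100)\<^sup>2" using False norm_le by (simp add: power2_eq_square)
    then have "norm y \<le> 65/100" by (rule power2_le_imp_le) simp
    then have "4 * exp (\<alpha> * (norm y)\<^sup>2) < 4 * cosh (\<alpha> * norm y)"
      using cosh_gt_exp_mult[OF assms(1), of "norm y"] y by simp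
    also have "\<dots> \<le> (\<Sum>i\<in>UNIV. cosh (2 * \<alpha> * y $ i))"
      using cosh_sqrt_average[OF _ avg] by simp
    finally show ?thesis .
  qed
qed

section \<open>Summability of Gaussians over integer vectors\<close>

lemma summable_on_exp_abs_Ints: "(\<lambda>t::real. exp (- \<bar>t\<bar>)) summable_on \<int>"
proof -
  have "summable (\<lambda>n. exp (-1::real) ^ n)" by (rule summable_geometric) simp
  then have "summable (\<lambda>n. exp (- real n))" by (simp flip: exp_of_nat_mult)
  then have nat: "(\<lambda>n. exp (- real n)) summable_on UNIV"
    by (subst summable_on_UNIV_nonneg_real_iff) auto
  have "(\<lambda>t::real. exp (- \<bar>t\<bar>)) summable_on range real"
    using nat by (subst summable_on_reindex) (auto simp: o_def)
  moreover have "(\<lambda>t::real. exp (- \<bar>t\<bar>)) summable_on range (\<lambda>n. - real n)"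
    using nat by (subst summable_on_reindex) (auto simp: o_def inj_def)
  ultimately have "(\<lambda>t::real. exp (- \<bar>t\<bar>)) summable_on (range real \<union> range (\<lambda>n. - real n))"
    by (rule summable_on_union)
  moreover have "\<int> \<subseteq> range real \<union> range (\<lambda>n. - real n)"
  proof
    fix t :: real assume "t \<in> \<int>"
    then obtain k where k: "t = of_int k" by (rule Ints_cases)
    show "t \<in> range real \<union> range (\<lambda>n. - real n)"
      by (cases k rule: int_cases2) (auto simp: k)
  qed
  ultimately show ?thesis by (rule summable_on_subset)
qed

text \<open>Any finite set of integer vectors lies in the box spanned by its coordinate projections.
  Over a box the sum factors into one-dimensional sums, each at most \<open>?K\<close>.\<close>

lemma summable_on_exp_norm_int_vectors:
  "(\<lambda>x::real^'n. exp (- (\<Sum>i\<in>UNIV. \<bar>x $ i\<bar>))) summable_on {x. \<forall>i. x $ i \<in> \<int>}"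
proof (rule nonneg_bdd_above_summable_on)
  let ?K = "infsum (\<lambda>t::real. exp (- \<bar>t\<bar>)) \<int>"
  show "bdd_above (sum (\<lambda>x::real^'n. exp (- (\<Sum>i\<in>UNIV. \<bar>x $ i\<bar>))) ` {F. F \<subseteq> {x. \<forall>i. x $ i \<in> \<int>} \<and> finite F})"
  proof (rule bdd_aboveI2)
    fix F :: "(real^'n) set"
    assume "F \<in> {F. F \<subseteq> {x. \<forall>i. x $ i \<in> \<int>} \<and> finite F}"
    then have F: "F \<subseteq> {x. \<forall>i. x $ i \<in> \<int>}" "finite F" by auto
    let ?B = "\<lambda>i. (\<lambda>x. x $ i) ` F"
    have "(\<Sum>x\<in>F. exp (- (\<Sum>i\<in>UNIV. \<bar>x $ i\<bar>))) = (\<Sum>x\<in>F. \<Prod>i\<in>UNIV. exp (- \<bar>x $ i\<bar>))"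
      by (simp add: exp_sum flip: sum_negf)
    also have "\<dots> = (\<Sum>g\<in>vec_nth ` F. \<Prod>i\<in>UNIV. exp (- \<bar>g i\<bar>))"
      by (subst sum.reindex) (auto simp: inj_on_def vec_nth_inject)
    also have "\<dots> \<le> (\<Sum>g\<in>PiE UNIV ?B. \<Prod>i\<in>UNIV. exp (- \<bar>g i\<bar>))"
      by (rule sum_mono2) (use F in \<open>auto intro!: finite_PiE prod_nonneg\<close>)
    also have "\<dots> = (\<Prod>i\<in>UNIV. \<Sum>t\<in>?B i. exp (- \<bar>t\<bar>))"
      by (rule prod_sum_PiE[symmetric]) (use F in auto)
    also have "\<dots> \<le> (\<Prod>i\<in>(UNIV::'n set). ?K)"
      by (intro prod_mono conjI sum_nonneg finite_sum_le_infsum summable_on_exp_abs_Ints)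
         (use F in auto)
    finally show "(\<Sum>x\<in>F. exp (- (\<Sum>i\<in>UNIV. \<bar>x $ i\<bar>))) \<le> (\<Prod>i\<in>(UNIV::'n set). ?K)" .
  qed
qed simp

text \<open>Completing the square gives \<alpha> t^2 \<ge> |t| - 1/(4 \<alpha>), so the Gaussian is
  dominated by a multiple of the exponential of minus the l1 norm.\<close>

lemma summable_on_gaussian_int_vectors:
  fixes z :: "real^'n"
  assumes "\<alpha> > 0"
  shows "(\<lambda>x. gaussian \<alpha> (norm (x - z))) summable_on {x. \<forall>i. x $ i \<in> \<int>}"
proof (rule summable_on_comparison_test)
  let ?C = "exp (\<Sum>i\<in>UNIV. \<bar>z $ i\<bar> + 1 / (4 * \<alpha>))"
  show "(\<lambda>x::real^'n. ?C * exp (- (\<Sum>i\<in>UNIV. \<bar>x $ i\<bar>))) summable_on {x. \<forall>i. x $ i \<in> \<int>}"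
    by (intro summable_on_cmult_right summable_on_exp_norm_int_vectors)
  fix x :: "real^'n"
  have "- (\<alpha> * t\<^sup>2) \<le> 1 / (4 * \<alpha>) - \<bar>t\<bar>" for t
  proof -
    have "0 \<le> \<alpha> * (\<bar>t\<bar> - 1 / (2 * \<alpha>))\<^sup>2" using assms by simp
    also have "\<dots> = \<alpha> * t\<^sup>2 - \<bar>t\<bar> + 1 / (4 * \<alpha>)"
      using assms by (simp add: power2_eq_square field_simps)
    finally show ?thesis by simp
  qed
  then have "- (\<alpha> * (x $ i - z $ i)\<^sup>2) \<le> \<bar>z $ i\<bar> + 1 / (4 * \<alpha>) - \<bar>x $ i\<bar>" for i
    using order_trans abs_triangle_ineq2[of "x $ i" "z $ i"] by (smt (verit))
  then have "(\<Sum>i\<in>UNIV. - (\<alpha> * (x $ i - z $ i)\<^sup>2)) \<le> (\<Sum>i\<in>UNIV. \<bar>z $ i\<bar> + 1 / (4 * \<alpha>) - \<bar>x $ i\<bar>)"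
    by (intro sum_mono)
  then show "gaussian \<alpha> (norm (x - z)) \<le> ?C * exp (- (\<Sum>i\<in>UNIV. \<bar>x $ i\<bar>))"
    by (simp add: gaussian_def norm_vec_def L2_set_def sum_nonneg sum_negf sum_subtractf sum_distrib_left
        flip: exp_add)
qed (simp add: gaussian_def)

section \<open>Symmetries and holes of the lattice\<close>

text \<open>Parity is phrased as integrality of half the coordinate sum, so that the closure
  properties of \<open>Ints\<close> decide membership.\<close>

lemma mem_D4_iff:
  "x \<in> D4 \<longleftrightarrow> (\<forall>i. x $ i \<in> \<int>) \<and> (\<Sum>i\<in>UNIV. x $ i) / 2 \<in> \<int>"
proof
  assume "x \<in> D4"
  then obtain k :: "int^4" where k: "x = (\<chi> i. real_of_int (k $ i))" "even (\<Sum>i\<in>UNIV. k $ i)"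
    by (auto simp: D4_def)
  from k(2) obtain m where "(\<Sum>i\<in>UNIV. k $ i) = 2 * m" by blast
  then have "(\<Sum>i\<in>UNIV. x $ i) = 2 * real_of_int m"
    by (simp add: k(1) flip: of_int_sum)
  then show "(\<forall>i. x $ i \<in> \<int>) \<and> (\<Sum>i\<in>UNIV. x $ i) / 2 \<in> \<int>"
    by (simp add: k(1))
next
  assume x: "(\<forall>i. x $ i \<in> \<int>) \<and> (\<Sum>i\<in>UNIV. x $ i) / 2 \<in> \<int>"
  define k :: "int^4" where "k = (\<chi> i. \<lfloor>x $ i\<rfloor>)"
  have k: "x = (\<chi> i. real_of_int (k $ i))"
    using x by (simp add: vec_eq_iff k_def)
  from x obtain m where "(\<Sum>i\<in>UNIV. x $ i) / 2 = real_of_int m" by (auto elim: Ints_cases)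
  then have "real_of_int (\<Sum>i\<in>UNIV. k $ i) = real_of_int (2 * m)"
    by (simp add: k)
  then have "even (\<Sum>i\<in>UNIV. k $ i)"
    by (simp only: of_int_eq_iff) simp
  then show "x \<in> D4" using k by (auto simp: D4_def)
qed

lemma summable_on_gaussian_D4:
  "\<alpha> > 0 \<Longrightarrow> (\<lambda>x. gaussian \<alpha> (norm (x - z))) summable_on D4"
  by (rule summable_on_subset[OF summable_on_gaussian_int_vectors]) (auto simp: mem_D4_iff)

lemma diff_in_D4:
  assumes "x \<in> D4" "y \<in> D4" shows "x - y \<in> D4"
  using assms by (auto simp: mem_D4_iff sum_subtractf diff_divide_distrib)

section \<open>Isometries preserving the lattice\<close>

text \<open>Distances are preserved on the whole space, because the maps are applied to arbitrary
  points z and not only to lattice points.\<close>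

definition D4_symmetry :: "(real^4 \<Rightarrow> real^4) \<Rightarrow> bool" where
  "D4_symmetry g \<longleftrightarrow> g ` D4 = D4 \<and> (\<forall>x y. dist (g x) (g y) = dist x y)"

lemma D4_symmetry_comp: "D4_symmetry g \<Longrightarrow> D4_symmetry h \<Longrightarrow> D4_symmetry (g \<circ> h)"
  by (simp add: D4_symmetry_def flip: image_image[of g h] add: image_comp[symmetric])

lemma D4_symmetry_translation:
  assumes "v \<in> D4" shows "D4_symmetry (\<lambda>x. x - v)"
proof -
  have "0 \<in> D4" by (simp add: mem_D4_iff)
  have "x + v \<in> D4" if "x \<in> D4" for x
    using diff_in_D4[OF that diff_in_D4[OF \<open>0 \<in> D4\<close> assms]] by simp
  then have "x \<in> (\<lambda>x. x - v) ` D4" if "x \<in> D4" for x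
    using that by (intro image_eqI[of _ _ "x + v"]) auto
  then show ?thesis
    using assms by (auto simp: D4_symmetry_def dist_norm diff_in_D4)
qed

text \<open>The map is the reflection in the hyperplane orthogonal to the unit vector
  \<open>r\<close>. It sends \<open>D4\<close> into itself by the assumption on \<open>r\<close>,
  and onto itself because it is an involution.\<close>

lemma D4_symmetry_reflection:
  assumes "norm r = 1" and r: "\<And>x. x \<in> D4 \<Longrightarrow> (2 * (x \<bullet> r)) *\<^sub>R r \<in> D4"
  shows "D4_symmetry (\<lambda>x. x - (2 * (x \<bullet> r)) *\<^sub>R r)"
proof -
  let ?g = "\<lambda>x. x - (2 * (x \<bullet> r)) *\<^sub>R r"
  have rr: "r \<bullet> r = 1" using assms(1) by (simp add: norm_eq_1)
  have g: "?g x \<in> D4" if "x \<in> D4" for x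
    using that by (intro diff_in_D4 r)
  have "?g x \<bullet> r = - (x \<bullet> r)" for x
    by (simp add: inner_diff_left rr)
  then have "?g (?g x) = x" for x by simp
  then have "x \<in> ?g ` D4" if "x \<in> D4" for x
    using g[OF that] by (metis (no_types, lifting) imageI)
  moreover have "dist (?g x) (?g y) = dist x y" for x y
  proof -
    have "?g x - ?g y = ?g (x - y)"
      by (simp add: inner_diff_left algebra_simps)
    moreover have "norm (?g u) = norm u" for u
      by (simp add: norm_eq inner_diff_left inner_diff_right rr inner_commute)
    ultimately show ?thesis unfolding dist_norm by metis
  qed
  ultimately show ?thesis
    using g by (auto simp: D4_symmetry_def)
qed

lemma infdist_D4_symmetry:
  assumes "D4_symmetry g" shows "infdist (g z) D4 = infdist z D4"
proof -
  have "dist (g z) ` g ` D4 = dist z ` D4"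
    unfolding image_image using assms by (simp add: D4_symmetry_def)
  then show ?thesis
    using assms by (simp add: infdist_def D4_symmetry_def)
qed

lemma potential_D4_symmetry:
  assumes "D4_symmetry g" shows "potential f D4 (g z) = potential f D4 z"
proof -
  have "inj_on g D4"
    using assms by (metis D4_symmetry_def dist_eq_0_iff inj_onI)
  then have "bij_betw g D4 D4"
    using assms by (simp add: bij_betw_def D4_symmetry_def)
  from infsum_reindex_bij_betw[OF this, of "\<lambda>x. f (norm (x - g z))"]
  show ?thesis
    using assms by (simp add: potential_def D4_symmetry_def dist_norm)
qed

text \<open>Coordinates are treated one at a time, reflecting in the coordinate hyperplane when the
  entry is negative. Such a reflection changes the coordinate sum of a lattice vector by the even
  number 2 x_j. The symmetry may depend on \<open>w\<close>.\<close>

lemma D4_symmetry_abs: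
  "\<exists>g. D4_symmetry g \<and> g w = (\<chi> i. if i \<in> S then \<bar>w $ i\<bar> else w $ i)"
proof (induction S rule: finite_induct[OF finite])
  case 1
  have "D4_symmetry (\<lambda>x. x)" by (simp add: D4_symmetry_def)
  then show ?case by (auto simp: vec_eq_iff)
next
  case (2 j S)
  then obtain g where g: "D4_symmetry g" "g w = (\<chi> i. if i \<in> S then \<bar>w $ i\<bar> else w $ i)"
    by blast
  have refl: "D4_symmetry (\<lambda>x. x - (2 * (x \<bullet> axis j 1)) *\<^sub>R axis j 1)"
  proof (rule D4_symmetry_reflection)
    fix x :: "real^4" assume "x \<in> D4"
    then show "(2 * (x \<bullet> axis j 1)) *\<^sub>R axis j 1 \<in> D4"
      unfolding mem_D4_iff inner_axis by (auto simp: axis_def if_distrib sum.delta cong: if_cong)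
  qed simp
  show ?case
  proof (cases "w $ j \<ge> 0")
    case True
    then have "g w = (\<chi> i. if i \<in> insert j S then \<bar>w $ i\<bar> else w $ i)"
      by (simp add: g vec_eq_iff)
    then show ?thesis using g by blast
  next
    case False
    have "((\<lambda>x. x - (2 * (x \<bullet> axis j 1)) *\<^sub>R axis j 1) \<circ> g) w = (\<chi> i. if i \<in> insert j S then \<bar>w $ i\<bar> else w $ i)"
      using False 2 by (simp add: g vec_eq_iff inner_axis) (simp add: axis_def)
    then show ?thesis
      using D4_symmetry_comp[OF refl g(1)] by blast
  qed
qed

section \<open>Moving a point into the cross polytope around e_1\<close>

text \<open>Rounding leaves errors of at most 1/2. If the parity is wrong, rerounding the coordinate
  with the largest error M replaces M by 1 - M, while all others stay at most M \<le> 1/2.\<close>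

lemma D4_translate_into_Voronoi_cell:
  fixes z :: "real^4"
  obtains v where "v \<in> D4" "\<And>i j. i \<noteq> j \<Longrightarrow> \<bar>(z - v) $ i\<bar> + \<bar>(z - v) $ j\<bar> \<le> 1"
proof -
  define u :: "real^4" where "u = (\<chi> i. of_int (round (z $ i)))"
  define w where "w = z - u"
  have half: "\<bar>w $ i\<bar> \<le> 1/2" for i
    using of_int_round_abs_le[of "z $ i"] by (simp add: w_def u_def abs_minus_commute)
  show thesis
  proof (cases "u \<in> D4")
    case True
    show thesis
    proof (rule that[OF True])
      fix i j show "\<bar>(z - u) $ i\<bar> + \<bar>(z - u) $ j\<bar> \<le> 1"
        using half[of i] half[of j] unfolding w_def by linarith
    qed
  next
    case False
    txt \<open>The rounded vector has the wrong parity, so round the worst coordinate the other way.\<close>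
    define M where "M = Max (range (\<lambda>i. \<bar>w $ i\<bar>))"
    have M_ge: "\<bar>w $ i\<bar> \<le> M" for i by (simp add: M_def)
    have "M \<in> range (\<lambda>i. \<bar>w $ i\<bar>)" unfolding M_def by (rule Max_in) auto
    then obtain m where m: "M = \<bar>w $ m\<bar>" by blast
    define s :: real where "s = (if w $ m \<ge> 0 then 1 else -1)"
    define v where "v = u + axis m s"
    have "(\<Sum>i\<in>UNIV. u $ i) = of_int (\<Sum>i\<in>UNIV. round (z $ i))" by (simp add: u_def)
    moreover have "odd (\<Sum>i\<in>UNIV. round (z $ i))"
    proof
      assume "even (\<Sum>i\<in>UNIV. round (z $ i))"
      then have "u \<in> D4"
        unfolding D4_def u_def by (intro CollectI exI[of _ "\<chi> i. round (z $ i)"]) simp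
      with False show False ..
    qed
    then obtain k where "(\<Sum>i\<in>UNIV. round (z $ i)) = 2 * k + 1" by (rule oddE)
    ultimately have sum_u: "(\<Sum>i\<in>UNIV. u $ i) = 2 * of_int k + 1" by simp
    have sum_v: "(\<Sum>i\<in>UNIV. v $ i) = (\<Sum>i\<in>UNIV. u $ i) + s"
      by (simp add: v_def sum.distrib axis_def)
    have "(\<Sum>i\<in>UNIV. v $ i) / 2 = of_int (if w $ m \<ge> 0 then k + 1 else k)"
      unfolding sum_v sum_u by (simp add: s_def)
    then have "(\<Sum>i\<in>UNIV. v $ i) / 2 \<in> \<int>" by (metis Ints_of_int)
    then have v: "v \<in> D4"
      by (auto simp: mem_D4_iff v_def u_def axis_def s_def)
    have m': "\<bar>(z - v) $ m\<bar> = 1 - M"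
      using half[of m] by (auto simp: v_def m s_def w_def)
    have other: "\<bar>(z - v) $ i\<bar> \<le> M" if "i \<noteq> m" for i
      using M_ge[of i] that by (simp add: v_def w_def axis_def)
    have "M \<le> 1/2" using half m by simp
    show thesis
    proof (rule that[OF v])
      fix i j :: 4 assume "i \<noteq> j"
      then consider "i = m" "j \<noteq> m" | "i \<noteq> m" "j = m" | "i \<noteq> m" "j \<noteq> m" by blast
      then show "\<bar>(z - v) $ i\<bar> + \<bar>(z - v) $ j\<bar> \<le> 1"
        by cases (use m' other[of i] other[of j] \<open>M \<le> 1/2\<close> in auto)
    qed
  qed
qed

text \<open>After a translation and sign changes, w is nonnegative with pair sums at most 1. If some
  w_j is at least half the coordinate sum, then w lies in the cross polytope around e_j; otherwise
  it lies in the one around (1/2, 1/2, 1/2, 1/2). Both centers are carried to e_1.\<close>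

lemma D4_symmetry_to_cross_polytope:
  fixes z :: "real^4"
  obtains g where "D4_symmetry g" "(\<Sum>i\<in>UNIV. \<bar>(g z - axis 1 1) $ i\<bar>) \<le> 1"
proof -
  obtain v where v: "v \<in> D4" "\<And>i j. i \<noteq> j \<Longrightarrow> \<bar>(z - v) $ i\<bar> + \<bar>(z - v) $ j\<bar> \<le> 1"
    using D4_translate_into_Voronoi_cell[of z] by blast
  obtain h where h: "D4_symmetry h" "h (z - v) = (\<chi> i. \<bar>(z - v) $ i\<bar>)"
    using D4_symmetry_abs[of "z - v" UNIV] by auto
  define w where "w = h (z - v)"
  have nonneg: "w $ i \<ge> 0" for i by (simp add: w_def h)
  have pair: "w $ i + w $ j \<le> 1" if "i \<noteq> j" for i j
    using v(2)[OF that] by (simp add: w_def h)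
  have trans: "D4_symmetry (\<lambda>x. h (x - v))"
    using D4_symmetry_comp[OF h(1) D4_symmetry_translation[OF v(1)]] by (simp add: o_def)
  show thesis
  proof (cases "\<exists>j. 2 * w $ j \<ge> (\<Sum>i\<in>UNIV. w $ i)")
    case True
    then obtain j where j: "2 * w $ j \<ge> (\<Sum>i\<in>UNIV. w $ i)" by blast
    have "axis j 1 - axis 1 1 \<in> D4"
      by (auto simp: mem_D4_iff axis_def sum_subtractf)
    then have "D4_symmetry (\<lambda>x. h (x - v) - (axis j 1 - axis 1 1))"
      using D4_symmetry_comp[OF D4_symmetry_translation trans] by (simp add: o_def)
    moreover have "(\<Sum>i\<in>UNIV. \<bar>(w - axis j 1) $ i\<bar>) \<le> 1"
    proof -
      \<comment> \<open>The index \<open>j + 1\<close>, cyclic in type \<open>4\<close>, merely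
        serves as a coordinate other than \<open>j\<close>.\<close>
      have "w $ j \<le> 1"
        using pair[of j "j + 1"] nonneg[of "j + 1"] by simp
      have "(\<Sum>i\<in>UNIV. \<bar>(w - axis j 1) $ i\<bar>) = \<bar>w $ j - 1\<bar> + (\<Sum>i\<in>UNIV - {j}. \<bar>(w - axis j 1) $ i\<bar>)"
        by (subst sum.remove[of _ j]) auto
      also have "(\<Sum>i\<in>UNIV - {j}. \<bar>(w - axis j 1) $ i\<bar>) = (\<Sum>i\<in>UNIV - {j}. w $ i)"
        by (rule sum.cong) (auto simp: axis_def nonneg)
      also have "\<dots> = (\<Sum>i\<in>UNIV. w $ i) - w $ j"
        by (subst sum.remove[of UNIV j]) auto
      finally show ?thesis using \<open>w $ j \<le> 1\<close> j by linarith
    qed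
    ultimately show thesis
      by (intro that[of "\<lambda>x. h (x - v) - (axis j 1 - axis 1 1)"]) (auto simp: w_def algebra_simps)
  next
    case False
    then have le: "2 * w $ j \<le> (\<Sum>i\<in>UNIV. w $ i)" for j by (metis linorder_le_cases)
    txt \<open>This reflection exchanges $e_1$ with the deep hole $(1/2, 1/2, 1/2, 1/2)$, which lies in another
      class modulo $D_4$.\<close>
    define r :: "real^4" where "r = (\<chi> i. if i = 1 then 1/2 else -1/2)"
    have inner_r: "2 * (x \<bullet> r) = x $ 1 - x $ 2 - x $ 3 - x $ 4" for x
      by (simp add: r_def inner_vec_def sum_4 field_simps)
    have refl: "D4_symmetry (\<lambda>x. x - (2 * (x \<bullet> r)) *\<^sub>R r)"
    proof (rule D4_symmetry_reflection)
      show "norm r = 1"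
        by (simp add: r_def norm_eq_1 inner_vec_def sum_4)
      fix x :: "real^4" assume x: "x \<in> D4"
      have "x $ 1 - x $ 2 - x $ 3 - x $ 4 = 2 * (x $ 1 - (\<Sum>i\<in>UNIV. x $ i) / 2)"
        by (simp add: sum_4 field_simps)
      moreover have "x $ 1 - (\<Sum>i\<in>UNIV. x $ i) / 2 \<in> \<int>"
        using x by (auto simp: mem_D4_iff)
      ultimately obtain m where m: "2 * (x \<bullet> r) = 2 * m" "m \<in> \<int>"
        using inner_r by metis
      show "(2 * (x \<bullet> r)) *\<^sub>R r \<in> D4"
        unfolding m(1) using m(2) by (auto simp: mem_D4_iff r_def sum_4)
    qed
    \<comment> \<open>Let S be the coordinate sum of w; S \<le> 2 by pairing. The first entry
      contributes 1 - S/2, the others |w_1 + w_i - S/2|. For each choice of signs the latter add up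
      to S/2 - 2 w_k or 2 w_k - S/2 for some k, hence to at most S/2 by \<open>nonneg\<close> and
      \<open>le\<close>.\<close>
    have "(\<Sum>i\<in>UNIV. \<bar>(w - (2 * (w \<bullet> r)) *\<^sub>R r - axis 1 1) $ i\<bar>) \<le> 1"
      using nonneg pair[of 1 2] pair[of 3 4] pair[of 1 3] pair[of 1 4] pair[of 2 3] pair[of 2 4]
        le[of 1] le[of 2] le[of 3] le[of 4] nonneg[of 1] nonneg[of 2] nonneg[of 3] nonneg[of 4]
      unfolding inner_r by (simp add: sum_4 r_def axis_def abs_if) 
    with D4_symmetry_comp[OF refl trans] show thesis
      by (intro that) (auto simp: o_def w_def)
  qed
qed

section \<open>The potential near a deep hole\<close>

definition odd_vectors :: "(real^4) set" where
  "odd_vectors = {x. x + axis 1 1 \<in> D4}"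

lemma mem_odd_vectors_iff:
  "x \<in> odd_vectors \<longleftrightarrow> (\<forall>i. x $ i \<in> \<int>) \<and> ((\<Sum>i\<in>UNIV. x $ i) + 1) / 2 \<in> \<int>"
proof -
  have "x $ i + axis 1 1 $ i \<in> \<int> \<longleftrightarrow> x $ i \<in> \<int>" for i
    by (simp add: axis_def)
  moreover have "(\<Sum>i\<in>UNIV. (x + axis 1 1) $ i) = (\<Sum>i\<in>UNIV. x $ i) + 1"
    by (simp add: sum.distrib axis_def)
  ultimately show ?thesis
    unfolding odd_vectors_def mem_D4_iff by simp
qed

lemma axis_in_odd_vectors: "axis j 1 \<in> odd_vectors"
  by (auto simp: mem_odd_vectors_iff axis_def)

lemma zero_notin_odd_vectors: "0 \<notin> odd_vectors"
  by (auto simp: mem_odd_vectors_iff elim!: Ints_cases)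

lemma uminus_in_odd_vectors:
  assumes "x \<in> odd_vectors" shows "- x \<in> odd_vectors"
proof -
  have "((\<Sum>i\<in>UNIV. (- x) $ i) + 1) / 2 = 1 - ((\<Sum>i\<in>UNIV. x $ i) + 1) / 2"
    by (simp add: sum_negf field_simps)
  also have "\<dots> \<in> \<int>" using assms by (intro Ints_diff) (auto simp: mem_odd_vectors_iff)
  finally show ?thesis
    using assms by (simp add: mem_odd_vectors_iff)
qed

text \<open>Keeps coordinate \<open>j\<close> and negates the others. With negation it generates a
  group of four sign changes, which separates the contribution of coordinate \<open>j\<close> to an
  inner product from the rest.\<close>

definition flip_other :: "4 \<Rightarrow> real^4 \<Rightarrow> real^4" where
  "flip_other j x = axis j (2 * x $ j) - x"

lemma flip_other_in_odd_vectors: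
  assumes "x \<in> odd_vectors" shows "flip_other j x \<in> odd_vectors"
proof -
  have "((\<Sum>i\<in>UNIV. flip_other j x $ i) + 1) / 2 = x $ j + ((\<Sum>i\<in>UNIV. (- x) $ i) + 1) / 2"
    by (simp add: flip_other_def sum_subtractf sum_negf axis_def field_simps)
  also have "\<dots> \<in> \<int>"
    using assms uminus_in_odd_vectors[OF assms] unfolding mem_odd_vectors_iff by (intro Ints_add) auto
  finally show ?thesis
    using assms by (simp add: mem_odd_vectors_iff flip_other_def axis_def)
qed

lemma flip_other_simps [simp]:
  "flip_other j x $ j = x $ j" "flip_other j (flip_other j x) = x" "norm (flip_other j x) = norm x"
  "flip_other j x \<bullet> y = 2 * (x $ j * y $ j) - x \<bullet> y"
proof -
  have inner: "flip_other j x \<bullet> y = 2 * (x $ j * y $ j) - x \<bullet> y" for x y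
    by (simp add: flip_other_def inner_diff_left inner_axis')
  then show "flip_other j x \<bullet> y = 2 * (x $ j * y $ j) - x \<bullet> y" .
  show *: "flip_other j x $ j = x $ j" for x
    by (simp add: flip_other_def)
  show "flip_other j (flip_other j x) = x"
    by (simp add: flip_other_def vec_eq_iff axis_def)
  show "norm (flip_other j x) = norm x"
    by (simp add: norm_eq inner * inner_commute[of x "flip_other j x"])
qed

text \<open>Recentering at e_1 and expanding the squared distance isolates the dependence on y in a
  common factor and in exponentials of \<open>x \<bullet> y\<close>.\<close>

lemma potential_at_shift:
  "potential (gaussian \<alpha>) D4 (axis 1 1 + y)
    = exp (- \<alpha> * (norm y)\<^sup>2) * (\<Sum>\<^sub>\<infinity>x\<in>odd_vectors. exp (- \<alpha> * (norm x)\<^sup>2) * exp (2 * \<alpha> * (x \<bullet> y)))"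
proof -
  have "potential (gaussian \<alpha>) D4 (axis 1 1 + y)
      = (\<Sum>\<^sub>\<infinity>x\<in>odd_vectors. exp (- \<alpha> * (norm y)\<^sup>2) * (exp (- \<alpha> * (norm x)\<^sup>2) * exp (2 * \<alpha> * (x \<bullet> y))))"
    unfolding potential_def
  proof (rule infsum_reindex_bij_witness[of _ "\<lambda>x. x + axis 1 1" "\<lambda>x. x - axis 1 1"])
    fix x :: "real^4"
    have "x - (axis 1 1 + y) = (x - axis 1 1) - y" by simp
    then show "exp (- \<alpha> * (norm y)\<^sup>2) * (exp (- \<alpha> * (norm (x - axis 1 1))\<^sup>2) * exp (2 * \<alpha> * ((x - axis 1 1) \<bullet> y)))
        = gaussian \<alpha> (norm (x - (axis 1 1 + y)))"
      unfolding gaussian_def by (simp add: dot_norm_neg field_simps flip: exp_add)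
  qed (auto simp: odd_vectors_def)
  then show ?thesis by (simp add: infsum_cmult_right')
qed

lemma summable_on_odd_vectors:
  assumes "\<alpha> > 0"
  shows "(\<lambda>x. exp (- \<alpha> * (norm x)\<^sup>2) * exp (2 * \<alpha> * (x \<bullet> y))) summable_on odd_vectors"
proof -
  have "(\<lambda>x. gaussian \<alpha> (norm (x - y))) summable_on odd_vectors"
    by (rule summable_on_subset[OF summable_on_gaussian_int_vectors]) (use assms in \<open>auto simp: mem_odd_vectors_iff\<close>)
  then have "(\<lambda>x. exp (\<alpha> * (norm y)\<^sup>2) * gaussian \<alpha> (norm (x - y))) summable_on odd_vectors"
    by (rule summable_on_cmult_right)
  moreover have "exp (\<alpha> * (norm y)\<^sup>2) * gaussian \<alpha> (norm (x - y)) = exp (- \<alpha> * (norm x)\<^sup>2) * exp (2 * \<alpha> * (x \<bullet> y))" for x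
    unfolding gaussian_def by (simp add: dot_norm_neg field_simps flip: exp_add)
  ultimately show ?thesis by simp
qed

section \<open>Distributing the Gaussian weights over the coordinates\<close>

text \<open>The share of coordinate \<open>j\<close> vanishes when x_j = 0, so on integer vectors
  only those with |x_j| \<ge> 1 count. The shares add up to the full Gaussian weight away from 0,
  and 0 is not in \<open>odd_vectors\<close>.\<close>

definition weight :: "real \<Rightarrow> 4 \<Rightarrow> real^4 \<Rightarrow> real" where
  "weight \<alpha> j x = exp (- \<alpha> * (norm x)\<^sup>2) * ((x $ j)\<^sup>2 / (norm x)\<^sup>2)"

lemma weight_nonneg: "0 \<le> weight \<alpha> j x"
  by (simp add: weight_def)

lemma weight_le: "weight \<alpha> j x \<le> exp (- \<alpha> * (norm x)\<^sup>2)"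
proof -
  have "(x $ j)\<^sup>2 / (norm x)\<^sup>2 \<le> 1"
    using power_mono[OF component_le_norm_cart[of x j], of 2] by (simp add: divide_le_eq)
  then show ?thesis
    unfolding weight_def by (rule mult_left_le) simp
qed

lemma sum_weight: "x \<noteq> 0 \<Longrightarrow> (\<Sum>j\<in>UNIV. weight \<alpha> j x) = exp (- \<alpha> * (norm x)\<^sup>2)"
proof -
  assume "x \<noteq> 0"
  moreover have "(\<Sum>j\<in>UNIV. (x $ j)\<^sup>2) = (norm x)\<^sup>2"
    unfolding power2_norm_eq_inner inner_vec_def by (simp add: power2_eq_square)
  ultimately show ?thesis
    unfolding weight_def by (simp flip: sum_distrib_left sum_divide_distrib)
qed

lemma summable_on_weight:
  assumes "\<alpha> > 0"
  shows "(\<lambda>x. weight \<alpha> j x * exp (2 * \<alpha> * (x \<bullet> y))) summable_on odd_vectors"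
  by (rule summable_on_comparison_test[OF summable_on_odd_vectors[OF assms, of y]])
     (auto intro!: mult_right_mono weight_le[simplified] simp: weight_nonneg)

lemma infsum_eq_sum_infsum_weight:
  assumes "\<alpha> > 0"
  shows "(\<Sum>\<^sub>\<infinity>x\<in>odd_vectors. exp (- \<alpha> * (norm x)\<^sup>2) * exp (2 * \<alpha> * (x \<bullet> y)))
    = (\<Sum>j\<in>UNIV. \<Sum>\<^sub>\<infinity>x\<in>odd_vectors. weight \<alpha> j x * exp (2 * \<alpha> * (x \<bullet> y)))"
proof -
  have "(\<Sum>\<^sub>\<infinity>x\<in>odd_vectors. exp (- \<alpha> * (norm x)\<^sup>2) * exp (2 * \<alpha> * (x \<bullet> y)))
      = (\<Sum>\<^sub>\<infinity>x\<in>odd_vectors. \<Sum>j\<in>UNIV. weight \<alpha> j x * exp (2 * \<alpha> * (x \<bullet> y)))"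
  proof (rule infsum_cong)
    fix x assume "x \<in> odd_vectors"
    then have "x \<noteq> 0" using zero_notin_odd_vectors by blast
    then show "exp (- \<alpha> * (norm x)\<^sup>2) * exp (2 * \<alpha> * (x \<bullet> y)) = (\<Sum>j\<in>UNIV. weight \<alpha> j x * exp (2 * \<alpha> * (x \<bullet> y)))"
      by (simp add: sum_weight flip: sum_distrib_right)
  qed
  also have "\<dots> = (\<Sum>j\<in>UNIV. \<Sum>\<^sub>\<infinity>x\<in>odd_vectors. weight \<alpha> j x * exp (2 * \<alpha> * (x \<bullet> y)))"
    using summable_on_weight[OF assms, of _ y]
    by (simp add: sum_4 infsum_add summable_on_add)
  finally show ?thesis .
qed

text \<open>Transposing coordinates preserves \<open>odd_vectors\<close> and the norm, so the four
  sums of weights agree; together they give the total.\<close>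

lemma infsum_weight:
  assumes "\<alpha> > 0"
  shows "(\<Sum>\<^sub>\<infinity>x\<in>odd_vectors. weight \<alpha> j x) = (\<Sum>\<^sub>\<infinity>x\<in>odd_vectors. exp (- \<alpha> * (norm x)\<^sup>2)) / 4"
proof -
  have "(\<Sum>\<^sub>\<infinity>x\<in>odd_vectors. weight \<alpha> k x) = (\<Sum>\<^sub>\<infinity>x\<in>odd_vectors. weight \<alpha> j x)" for k
  proof -
    let ?p = "Transposition.transpose j k"
    let ?s = "\<lambda>x::real^4. \<chi> i. x $ ?p i"
    have bij: "bij_betw ?p UNIV UNIV" by simp
    have s: "?s x \<in> odd_vectors" if "x \<in> odd_vectors" for x
      using that sum.reindex_bij_betw[OF bij, of "\<lambda>i. x $ i"] by (simp add: mem_odd_vectors_iff)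
    have norm: "norm (?s x) = norm x" for x
      using sum.reindex_bij_betw[OF bij, of "\<lambda>i. (norm (x $ i))\<^sup>2"] by (simp add: norm_vec_def L2_set_def)
    show ?thesis
      by (rule infsum_reindex_bij_witness[of _ ?s ?s]) (simp_all add: s norm weight_def)
  qed
  then have "(\<Sum>k\<in>UNIV. \<Sum>\<^sub>\<infinity>x\<in>odd_vectors. weight \<alpha> k x) = (\<Sum>k\<in>(UNIV::4 set). \<Sum>\<^sub>\<infinity>x\<in>odd_vectors. weight \<alpha> j x)"
    by (intro sum.cong) auto
  then show ?thesis
    using infsum_eq_sum_infsum_weight[OF assms, of 0] by simp
qed

text \<open>The sum is averaged over the four images of x under negation and
  \<open>flip_other\<close>. With u the full exponent and v the part from coordinate
  \<open>j\<close>, the average exponential is cosh v cosh(u - v) \<ge> cosh v, and |x_j| \<ge> 1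
  gives cosh v \<ge> cosh(2 \<alpha> y_j).\<close>

lemma infsum_weight_exp_ge:
  assumes "\<alpha> > 0"
  shows "cosh (2 * \<alpha> * y $ j) * (\<Sum>\<^sub>\<infinity>x\<in>odd_vectors. weight \<alpha> j x)
    \<le> (\<Sum>\<^sub>\<infinity>x\<in>odd_vectors. weight \<alpha> j x * exp (2 * \<alpha> * (x \<bullet> y)))"
proof -
  let ?f = "\<lambda>x. weight \<alpha> j x * exp (2 * \<alpha> * (x \<bullet> y))"
  let ?R = "flip_other j"
  have sumf: "?f summable_on odd_vectors" by (rule summable_on_weight[OF assms])
  have flips: "(\<lambda>x. ?f (- x)) summable_on odd_vectors \<and> infsum (\<lambda>x. ?f (- x)) odd_vectors = infsum ?f odd_vectors"
    "(\<lambda>x. ?f (?R x)) summable_on odd_vectors \<and> infsum (\<lambda>x. ?f (?R x)) odd_vectors = infsum ?f odd_vectors"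
    "(\<lambda>x. ?f (- ?R x)) summable_on odd_vectors \<and> infsum (\<lambda>x. ?f (- ?R x)) odd_vectors = infsum ?f odd_vectors"
  proof -
    have R: "bij_betw ?R odd_vectors odd_vectors"
      by (rule bij_betw_byWitness[of _ ?R]) (auto simp: flip_other_in_odd_vectors)
    have m: "bij_betw uminus odd_vectors odd_vectors"
      by (rule bij_betw_byWitness[of _ uminus]) (auto simp: uminus_in_odd_vectors)
    have "(\<lambda>x. ?f (h x)) summable_on odd_vectors \<and> infsum (\<lambda>x. ?f (h x)) odd_vectors = infsum ?f odd_vectors"
      if "bij_betw h odd_vectors odd_vectors" for h
      using sumf summable_on_reindex_bij_betw[OF that, of ?f] infsum_reindex_bij_betw[OF that, of ?f] by blast
    from this[OF m] this[OF R] this[OF bij_betw_trans[OF R m]]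
    show "(\<lambda>x. ?f (- x)) summable_on odd_vectors \<and> infsum (\<lambda>x. ?f (- x)) odd_vectors = infsum ?f odd_vectors"
    "(\<lambda>x. ?f (?R x)) summable_on odd_vectors \<and> infsum (\<lambda>x. ?f (?R x)) odd_vectors = infsum ?f odd_vectors"
    "(\<lambda>x. ?f (- ?R x)) summable_on odd_vectors \<and> infsum (\<lambda>x. ?f (- ?R x)) odd_vectors = infsum ?f odd_vectors"
      by (simp_all add: o_def)
  qed
  have "4 * (cosh (2 * \<alpha> * y $ j) * (\<Sum>\<^sub>\<infinity>x\<in>odd_vectors. weight \<alpha> j x))
      = (\<Sum>\<^sub>\<infinity>x\<in>odd_vectors. 4 * cosh (2 * \<alpha> * y $ j) * weight \<alpha> j x)"
    by (simp add: infsum_cmult_right' flip: mult.assoc)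
  also have "\<dots> \<le> (\<Sum>\<^sub>\<infinity>x\<in>odd_vectors. ?f x + ?f (- x) + ?f (?R x) + ?f (- ?R x))"
  proof (rule infsum_mono)
    show "(\<lambda>x. 4 * cosh (2 * \<alpha> * y $ j) * weight \<alpha> j x) summable_on odd_vectors"
      using summable_on_weight[OF assms, of j 0] by (intro summable_on_cmult_right) simp
    show "(\<lambda>x. ?f x + ?f (- x) + ?f (?R x) + ?f (- ?R x)) summable_on odd_vectors"
      using flips by (intro summable_on_add sumf) auto
    fix x assume x: "x \<in> odd_vectors"
    define u where "u = 2 * \<alpha> * (x \<bullet> y)"
    define v where "v = 2 * \<alpha> * (x $ j * y $ j)"
    show "4 * cosh (2 * \<alpha> * y $ j) * weight \<alpha> j x \<le> ?f x + ?f (- x) + ?f (?R x) + ?f (- ?R x)"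
    proof (cases "x $ j = 0")
      case True
      then show ?thesis by (simp add: weight_def)
    next
      case False
      have "\<bar>x $ j\<bar> \<ge> 1"
        using x False by (auto simp: mem_odd_vectors_iff intro: Ints_nonzero_abs_ge1)
      then have "\<bar>2 * \<alpha> * y $ j\<bar> \<le> \<bar>v\<bar>"
        using mult_right_mono[of 1 "\<bar>x $ j\<bar>" "\<bar>2 * \<alpha> * y $ j\<bar>"] by (simp add: v_def abs_mult mult_ac)
      then have "cosh (2 * \<alpha> * y $ j) \<le> cosh v"
        using cosh_real_nonneg_le_iff[of "\<bar>2 * \<alpha> * y $ j\<bar>" "\<bar>v\<bar>"] by (simp del: abs_mult)
      also have "\<dots> \<le> cosh v * cosh (u - v)"
        using mult_left_mono[OF cosh_real_ge_1[of "u - v"], of "cosh v"] by simp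
      finally have "4 * cosh (2 * \<alpha> * y $ j) \<le> 4 * (cosh v * cosh (u - v))" by simp
      also have "\<dots> = exp u + exp (- u) + exp (2 * v - u) + exp (u - 2 * v)"
        by (simp add: cosh_field_def field_simps flip: exp_add)
      finally have "weight \<alpha> j x * (4 * cosh (2 * \<alpha> * y $ j)) \<le> weight \<alpha> j x * \<dots>"
        by (rule mult_left_mono) (rule weight_nonneg)
      also have "\<dots> = ?f x + ?f (- x) + ?f (?R x) + ?f (- ?R x)"
      proof -
        have "weight \<alpha> j (- x) = weight \<alpha> j x" "weight \<alpha> j (?R x) = weight \<alpha> j x"
          "weight \<alpha> j (- ?R x) = weight \<alpha> j x"
          by (simp_all add: weight_def)
        moreover have "2 * \<alpha> * (x \<bullet> y) = u" "2 * \<alpha> * (- x \<bullet> y) = - u"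
          "2 * \<alpha> * (?R x \<bullet> y) = 2 * v - u" "2 * \<alpha> * (- ?R x \<bullet> y) = u - 2 * v"
          by (simp_all add: u_def v_def algebra_simps)
        ultimately show ?thesis by (simp only: distrib_left)
      qed
      finally show ?thesis by (simp only: mult_ac)
    qed
  qed
  also have "\<dots> = 4 * infsum ?f odd_vectors"
    using flips by (simp add: infsum_add sumf summable_on_add)
  finally show ?thesis by simp
qed

section \<open>Strict growth of the potential away from e_1\<close>

text \<open>The coordinatewise bounds are added; each coordinate carries a quarter of the total
  weight, which produces the average of the hyperbolic cosines.\<close>

lemma potential_ge:
  assumes "\<alpha> > 0"
  shows "exp (- \<alpha> * (norm y)\<^sup>2) * ((\<Sum>j\<in>UNIV. cosh (2 * \<alpha> * y $ j)) / 4) * potential (gaussian \<alpha>) D4 (axis 1 1)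
    \<le> potential (gaussian \<alpha>) D4 (axis 1 1 + y)"
proof -
  have "(\<Sum>j\<in>UNIV. cosh (2 * \<alpha> * y $ j)) / 4 * potential (gaussian \<alpha>) D4 (axis 1 1)
      = (\<Sum>j\<in>UNIV. cosh (2 * \<alpha> * y $ j) * (\<Sum>\<^sub>\<infinity>x\<in>odd_vectors. weight \<alpha> j x))"
    using potential_at_shift[of \<alpha> 0]
    by (simp add: infsum_weight[OF assms] sum_distrib_right sum_divide_distrib)
  also have "\<dots> \<le> (\<Sum>j\<in>UNIV. \<Sum>\<^sub>\<infinity>x\<in>odd_vectors. weight \<alpha> j x * exp (2 * \<alpha> * (x \<bullet> y)))"
    by (intro sum_mono infsum_weight_exp_ge assms)
  also have "\<dots> = (\<Sum>\<^sub>\<infinity>x\<in>odd_vectors. exp (- \<alpha> * (norm x)\<^sup>2) * exp (2 * \<alpha> * (x \<bullet> y)))"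
    by (rule infsum_eq_sum_infsum_weight[OF assms, symmetric])
  finally show ?thesis
    unfolding potential_at_shift mult.assoc by (intro mult_left_mono) simp_all
qed

lemma potential_pos:
  assumes "\<alpha> > 0" shows "potential (gaussian \<alpha>) D4 z > 0"
proof -
  have "0 \<in> D4" by (simp add: mem_D4_iff)
  then have "(\<Sum>x\<in>{0}. gaussian \<alpha> (norm (x - z))) \<le> potential (gaussian \<alpha>) D4 z"
    unfolding potential_def
    by (intro finite_sum_le_infsum summable_on_gaussian_D4 assms) (auto simp: gaussian_def)
  moreover have "(\<Sum>x\<in>{0}. gaussian \<alpha> (norm (x - z))) > 0" by (simp add: gaussian_def)
  ultimately show ?thesis by linarith
qed

lemma potential_gt:
  assumes "\<alpha> \<ge> 5" "(\<Sum>i\<in>UNIV. \<bar>y $ i\<bar>) \<le> 1" "y \<noteq> 0"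
  shows "potential (gaussian \<alpha>) D4 (axis 1 1) < potential (gaussian \<alpha>) D4 (axis 1 1 + y)"
proof -
  let ?P = "potential (gaussian \<alpha>) D4"
  have "1 = exp (- \<alpha> * (norm y)\<^sup>2) * exp (\<alpha> * (norm y)\<^sup>2)"
    by (simp flip: exp_add)
  also have "\<dots> < exp (- \<alpha> * (norm y)\<^sup>2) * ((\<Sum>j\<in>UNIV. cosh (2 * \<alpha> * y $ j)) / 4)"
    using exp_norm_less_average_cosh[OF assms] by (intro mult_strict_left_mono) simp_all
  finally have "1 * ?P (axis 1 1) < exp (- \<alpha> * (norm y)\<^sup>2) * ((\<Sum>j\<in>UNIV. cosh (2 * \<alpha> * y $ j)) / 4) * ?P (axis 1 1)"
    using assms(1) by (intro mult_strict_right_mono potential_pos) simp_all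
  also have "\<dots> \<le> ?P (axis 1 1 + y)"
    using assms(1) by (intro potential_ge) simp
  finally show ?thesis by simp
qed

section \<open>Distance to the lattice\<close>

text \<open>For the coordinate \<open>j\<close> of \<open>norm_square_le_component\<close>, the
  lattice point e_1 + sgn(y_j) e_j is close enough: its squared distance is 1 +
  (\<open>norm y\<close>)^2 - 2 |y_j| \<le> 1 - |y_j|.\<close>

lemma infdist_D4_lt:
  assumes "(\<Sum>i\<in>UNIV. \<bar>y $ i\<bar>) \<le> 1" "y \<noteq> 0"
  shows "infdist (axis 1 1 + y) D4 < 1"
proof -
  obtain j where "y $ j \<noteq> 0" and norm_le: "(norm y)\<^sup>2 \<le> \<bar>y $ j\<bar>"
    using norm_square_le_component[OF assms] by blast
  define x where "x = axis j (sgn (y $ j))"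
  have "axis j (- 1) = - (axis j 1 :: real^4)"
    by (simp add: vec_eq_iff axis_def)
  then have x: "x + axis 1 1 \<in> D4"
    using axis_in_odd_vectors[of j] uminus_in_odd_vectors[OF axis_in_odd_vectors[of j]] \<open>y $ j \<noteq> 0\<close>
    by (auto simp: x_def odd_vectors_def sgn_if)
  have "(norm (x - y))\<^sup>2 = 1 + (norm y)\<^sup>2 - 2 * \<bar>y $ j\<bar>"
    using \<open>y $ j \<noteq> 0\<close>
    by (simp add: power2_norm_eq_inner inner_diff_left inner_diff_right x_def inner_axis inner_axis' abs_sgn sgn_if algebra_simps)
  also note norm_le
  finally have "(norm (x - y))\<^sup>2 < 1\<^sup>2" using \<open>y $ j \<noteq> 0\<close> by simp
  then have "norm (x - y) < 1" by (rule power_less_imp_less_base) simp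
  then have "dist (axis 1 1 + y) (x + axis 1 1) < 1"
    by (simp add: dist_norm norm_minus_commute[of x y] algebra_simps)
  then show ?thesis
    using infdist_le[OF x, of "axis 1 1 + y"] by linarith
qed

text \<open>Differences between lattice points and e_1 are nonzero integer vectors, hence of norm at
  least 1; the origin attains this value.\<close>

lemma infdist_D4_axis: "infdist (axis 1 1) D4 = 1"
proof (rule antisym)
  have "0 \<in> D4" by (simp add: mem_D4_iff)
  then show "infdist (axis 1 1) D4 \<le> 1"
    using infdist_le[of "0::real^4" D4 "axis 1 1"] by simp
  have "1 \<le> dist (axis 1 1) x" if "x \<in> D4" for x
  proof -
    have odd: "x - axis 1 1 \<in> odd_vectors" using that by (simp add: odd_vectors_def)
    then obtain j where "(x - axis 1 1) $ j \<noteq> 0"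
      using zero_notin_odd_vectors by (metis vec_eq_iff zero_index)
    then have "1 \<le> \<bar>(x - axis 1 1) $ j\<bar>"
      using odd by (auto simp only: mem_odd_vectors_iff intro: Ints_nonzero_abs_ge1)
    also have "\<dots> \<le> dist (axis 1 1) x"
      using component_le_norm_cart[of "x - axis 1 1" j] by (simp only: dist_norm norm_minus_commute)
    finally show ?thesis .
  qed
  then show "1 \<le> infdist (axis 1 1) D4"
    using \<open>0 \<in> D4\<close> by (auto simp: infdist_def intro!: cINF_greatest)
qed

theorem theorem3p9:
  fixes \<alpha> :: real
  assumes "\<alpha> \<ge> 5"
  shows "minimizers (potential (gaussian \<alpha>) D4) = {c. deep_hole D4 c}"
proof -
  let ?P = "potential (gaussian \<alpha>) D4"
  \<comment> \<open>Each point either ties with e_1 in both potential and distance or is strictly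
    worse in both, so the two extremal sets coincide.\<close>
  have normal_form: "(?P z = ?P (axis 1 1) \<and> infdist z D4 = 1) \<or> (?P z > ?P (axis 1 1) \<and> infdist z D4 < 1)" for z
  proof -
    obtain g where g: "D4_symmetry g" "(\<Sum>i\<in>UNIV. \<bar>(g z - axis 1 1) $ i\<bar>) \<le> 1"
      using D4_symmetry_to_cross_polytope[of z] by blast
    show ?thesis
      using potential_gt[OF assms g(2)] infdist_D4_lt[OF g(2)] infdist_D4_axis
        potential_D4_symmetry[OF g(1), of "gaussian \<alpha>" z] infdist_D4_symmetry[OF g(1), of z]
      by (cases "g z = axis 1 1") auto
  qed
  have "z \<in> minimizers ?P \<longleftrightarrow> ?P z = ?P (axis 1 1)" for z
  proof -
    have "?P (axis 1 1) \<le> ?P w" for w using normal_form[of w] by auto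
    then show ?thesis by (auto simp: minimizers_def intro: antisym)
  qed
  moreover have "deep_hole D4 z \<longleftrightarrow> infdist z D4 = 1" for z
  proof -
    have "infdist w D4 \<le> 1" for w using normal_form[of w] by auto
    then show ?thesis
      using infdist_D4_axis unfolding deep_hole_def by (metis order_antisym)
  qed
  moreover have "?P z = ?P (axis 1 1) \<longleftrightarrow> infdist z D4 = 1" for z
    using normal_form[of z] by auto
  ultimately show ?thesis by blast
qed

end
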